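(* Let $d\geq 3$ be an integer. For functions $\alpha$ and $k$ with positive values, defined for all sufficiently large positive integers $n$, consider the limit condition $$(\ast)\qquad \limsup_{n\to\infty}\ \alpha(n)^{-(d-1)}\left(\frac{e\,C_d^*\,n\,\alpha(n)}{k(n)}\right)^{k(n)}<1 .$$ i) If $\alpha(n)=n^{-(1+\delta)}$ for some $\delta>0$, then there exists a constant $c(\delta)$ (a positive integer, for the fixed dimension $d$) such that the constant function $k(n)=c(\delta)$ satisfies $(\ast)$. Moreover, if $\delta>d-1$, then $k(n)=d$ satisfies $(\ast)$. ii) There is a suitable constant $B_d>0$ such that the pair of functions $\alpha(n)=\frac1n$, $k(n)=B_d\frac{\ln n}{\ln\ln n}$ satisfies $(\ast)$.
   Context: $\kappa_j$ denotes the volume of the $j$-dimensional Euclidean unit ball, $m_d=\sqrt{2\pi d}+1$, and $$C_d^*=\frac{4(m_d+1)(d-1)\kappa_{d-1}}{d\kappa_{d}}.$$ *)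

theory Defs
  imports "HOL-Analysis.Analysis"
begin

definition m_const :: "nat \<Rightarrow> real" where
  "m_const d = sqrt (2 * pi * real d) + 1"

text \<open>The volume of the \<open>j\<close>-dimensional Euclidean unit ball is the library's \<^const>\<open>unit_ball_vol\<close>
  (its link to the Lebesgue measure of balls is \<open>content_ball\<close>).\<close>

definition C_star :: "nat \<Rightarrow> real" where
  "C_star d = 4 * (m_const d + 1) * (real d - 1) * unit_ball_vol (real (d - 1))
                / (real d * unit_ball_vol (real d))"

text \<open>The limes superior is taken in the extended reals, so that it exists without any
  boundedness assumption. It only depends on the values of \<open>\<alpha>\<close> and \<open>k\<close> at large \<open>n\<close>; the condition
  is meant for \<open>\<alpha>\<close> and \<open>k\<close> that are positive there, so that both bases of \<open>powr\<close> are positive.\<close>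

definition limsup_condition :: "nat \<Rightarrow> (nat \<Rightarrow> real) \<Rightarrow> (nat \<Rightarrow> real) \<Rightarrow> bool" where
  "limsup_condition d \<alpha> k \<longleftrightarrow>
     limsup (\<lambda>n. ereal (\<alpha> n powr (- (real d - 1))
                        * (exp 1 * C_star d * real n * \<alpha> n / k n) powr k n)) < 1"

end

theory Submission
  imports Defs "HOL-Real_Asymp.Real_Asymp"
begin

lemma C_star_pos:
  assumes "d \<ge> 2"
  shows "C_star d > 0"
proof -
  have "m_const d \<ge> 1"
    by (simp add: m_const_def)
  with assms show ?thesis
    by (simp add: C_star_def)
qed

text \<open>In every case considered the expression does more than stay below 1: it tends to 0. A
  limit in the reals carries over to \<open>ereal\<close> and equals the limes superior there, so
  each case becomes a plain limit computation.\<close>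

lemma limsup_condition_if_tendsto_0:
  assumes "(\<lambda>n. \<alpha> n powr (- (real d - 1))
             * (exp 1 * C_star d * real n * \<alpha> n / k n) powr k n) \<longlonglongrightarrow> 0"
  shows "limsup_condition d \<alpha> k"
proof -
  from assms have "limsup (\<lambda>n. ereal (\<alpha> n powr (- (real d - 1))
             * (exp 1 * C_star d * real n * \<alpha> n / k n) powr k n)) = ereal 0"
    by (intro lim_imp_Limsup) auto
  then show ?thesis
    by (simp add: limsup_condition_def)
qed

text \<open>For constant \<open>c\<close> the expression is a constant times a single power of n:
  the first factor grows with exponent (1 + \<delta>)(d - 1), the second decays with exponent
  \<delta> c. The third assumption says that the decay wins.\<close>

lemma limsup_condition_powr:
  fixes \<delta> c :: real
  assumes "d \<ge> 2" "c > 0" "(1 + \<delta>) * (real d - 1) < \<delta> * c"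
  shows "limsup_condition d (\<lambda>n. real n powr (- (1 + \<delta>))) (\<lambda>n. c)"
proof (rule limsup_condition_if_tendsto_0)
  define K where "K = exp 1 * C_star d / c"
  have "K > 0"
    using assms C_star_pos by (simp add: K_def)
  have "(\<lambda>n. K powr c * real n powr ((1 + \<delta>) * (real d - 1) - \<delta> * c)) \<longlonglongrightarrow> 0"
    using assms(3) by (intro tendsto_mult_right_zero tendsto_neg_powr filterlim_real_sequentially) auto
  \<comment> \<open>Since n n^(-(1 + \<delta>)) = n^(-\<delta>), the base of the outer power is
    \<open>K\<close> times n^(-\<delta>), and the powers of n can be merged.\<close>
  moreover have "\<forall>\<^sub>F n in sequentially.
      K powr c * real n powr ((1 + \<delta>) * (real d - 1) - \<delta> * c)
      = (real n powr (- (1 + \<delta>))) powr (- (real d - 1))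
        * (exp 1 * C_star d * real n * real n powr (- (1 + \<delta>)) / c) powr c"
    using eventually_gt_at_top[of 0]
  proof eventually_elim
    case (elim n)
    have "real n * real n powr (- (1 + \<delta>)) = real n powr (- \<delta>)"
      using elim by (simp add: powr_mult_base)
    then have "exp 1 * C_star d * real n * real n powr (- (1 + \<delta>)) / c = K * real n powr (- \<delta>)"
      by (simp add: K_def mult.assoc)
    then show ?case
      using elim \<open>K > 0\<close> by (simp add: powr_mult powr_powr algebra_simps flip: powr_add)
  qed
  ultimately show "(\<lambda>n. (real n powr (- (1 + \<delta>))) powr (- (real d - 1))
        * (exp 1 * C_star d * real n * real n powr (- (1 + \<delta>)) / c) powr c) \<longlonglongrightarrow> 0"
    by (rule Lim_transform_eventually)
qed

text \<open>With \<open>k(n) = B ln n / ln ln n\<close>, the logarithm of the expression is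
  \<open>(d - 1 - B + o(1)) ln n\<close>, so every \<open>B > d - 1\<close> works; we take \<open>B = d\<close>.\<close>

lemma limsup_condition_inverse:
  assumes "d \<ge> 2"
  shows "limsup_condition d (\<lambda>n. 1 / real n) (\<lambda>n. real d * ln (real n) / ln (ln (real n)))"
proof (rule limsup_condition_if_tendsto_0)
  define K where "K = exp 1 * C_star d"
  define D where "D = real d"
  have "K > 0" "D > 0"
    using assms C_star_pos by (simp_all add: K_def D_def)
  \<comment> \<open>With \<open>K\<close> and \<open>D\<close> opaque, only their positivity enters
    the asymptotic expansion. The logarithm is (-1 + o(1)) ln n.\<close>
  then have "(\<lambda>n. (1 / real n) powr (- (D - 1))
        * (K * real n * (1 / real n) / (D * ln (real n) / ln (ln (real n))))
          powr (D * ln (real n) / ln (ln (real n)))) \<longlonglongrightarrow> 0"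
    by real_asymp
  then show "(\<lambda>n. (1 / real n) powr (- (real d - 1))
        * (exp 1 * C_star d * real n * (1 / real n) / (real d * ln (real n) / ln (ln (real n))))
          powr (real d * ln (real n) / ln (ln (real n)))) \<longlonglongrightarrow> 0"
    by (simp add: K_def D_def)
qed

theorem proposition1:
  fixes d :: nat
  assumes "d \<ge> 3"
  shows "(\<forall>\<delta>::real. \<delta> > 0 \<longrightarrow>
            (\<exists>c::nat. c > 0 \<and>
               limsup_condition d (\<lambda>n. real n powr (- (1 + \<delta>))) (\<lambda>n. real c)) \<and>
            (\<delta> > real d - 1 \<longrightarrow>
               limsup_condition d (\<lambda>n. real n powr (- (1 + \<delta>))) (\<lambda>n. real d))) \<and>
         (\<exists>B::real. B > 0 \<and>
            limsup_condition d (\<lambda>n. 1 / real n) (\<lambda>n. B * ln (real n) / ln (ln (real n))))"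
proof (intro conjI allI impI)
  fix \<delta> :: real
  assume "\<delta> > 0"
  \<comment> \<open>The threshold is the exponent condition of \<open>limsup_condition_powr\<close>
    solved for \<open>c\<close>.\<close>
  obtain c :: nat where c: "(1 + \<delta>) * (real d - 1) / \<delta> < real c"
    using reals_Archimedean2 by blast
  have "0 \<le> (1 + \<delta>) * (real d - 1) / \<delta>"
    using \<open>\<delta> > 0\<close> assms by simp
  with c have "c > 0"
    by linarith
  moreover have "(1 + \<delta>) * (real d - 1) < \<delta> * real c"
    using c \<open>\<delta> > 0\<close> by (simp add: field_simps)
  ultimately show "\<exists>c::nat. c > 0 \<and>
      limsup_condition d (\<lambda>n. real n powr (- (1 + \<delta>))) (\<lambda>n. real c)"
    using limsup_condition_powr[of d "real c" \<delta>] assms by auto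
next
  fix \<delta> :: real
  assume "\<delta> > real d - 1"
  \<comment> \<open>For \<open>c\<close> = d, cancelling \<delta>(d - 1) turns the exponent
    condition (1 + \<delta>)(d - 1) < \<delta> d into exactly d - 1 < \<delta>.\<close>
  then show "limsup_condition d (\<lambda>n. real n powr (- (1 + \<delta>))) (\<lambda>n. real d)"
    using assms by (intro limsup_condition_powr) (auto simp: algebra_simps)
next
  show "\<exists>B::real. B > 0 \<and>
      limsup_condition d (\<lambda>n. 1 / real n) (\<lambda>n. B * ln (real n) / ln (ln (real n)))"
    using limsup_condition_inverse[of d] assms by (intro exI[of _ "real d"]) auto
qed

end
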